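(* Let $m\in\mathbb N$, $\varepsilon\in[-1,1]$, let $f$ be a hint function, and let $(a_v)_{v\in\widehat V}$ be a feasible solution of the linear program (P) of the online binomial game $G_{m,\varepsilon,f}$: $$\max\ \sum_{v\in\widehat V}a_v\,(c_v-v_v)\quad\text{s.t.}\quad a_v+\sum_{u\in\widehat V:\,u<v}a_u\Pr[v\mid u]\le\Pr[v]\ \ \forall v\in\widehat V,\qquad a_v\ge0\ \ \forall v\in\widehat V .$$ Let $T$ be the strategy that, whenever the execution reaches a state $v$ and $T$ did not abort in any previous state, aborts at $v$ with probability $$\frac{a_v}{\Pr[v]-\sum_{u<v}a_u\Pr[v\mid u]}$$ (interpreted as $0$ when the denominator is $0$). Then $T$ is a valid strategy (i.e. these quantities are in $[0,1]$), and it achieves bias $\mathrm{bias}_T=\sum_{v\in\widehat V}a_v\,(c_v-v_v)$.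
   Context: Distributions: for $\varepsilon\in[-1,1]$, $\mathcal C_{\varepsilon}$ is the distribution on $\{-1,1\}$ giving $1$ probability $\frac12(1+\varepsilon)$; $\mathcal C_{n,\varepsilon}$ is the distribution of the sum of $n$ independent $\mathcal C_\varepsilon$ variables. Online binomial game: let $f$ be a randomized function (taking values in a finite set) on $[m]\times\mathbb Z\times\mathbb Z$, called the hint function. In the $m$-round game $G_{m,\varepsilon,f}$, independent coins $C_i\leftarrow\mathcal C_{(m-i+1)^2,\varepsilon}$, $i\in[m]$, are drawn; $S_0=0$, $S_i=\sum_{j\le i}C_j$, and the hint of round $i$ is $H_i=f(i,S_{i-1},C_i)$ (with fresh independent randomness of $f$ in each round). A strategy $T$ is a (possibly randomized, possibly stateful) algorithm which in round $i=1,\dots,m$ receives $(S_{i-1},H_i)$ and outputs a bit, using private randomness independent of the game; $I_T$ is the first round in which it outputs $1$ ("aborts"), and $I_T=m+1$ if it never does. Let $\delta_i(b)=\Pr[S_m\ge0\mid S_{i-1}=b]$, $\delta_i(b,h)=\Pr[S_m\ge0\mid S_{i-1}=b,H_i=h]$, and for $i\in[m]$ let $O_i=\delta_i(S_{i-1},H_i)$, $O_i^-=\delta_i(S_{i-1})$, while $O_{m+1}=O^-_{m+1}$ is the indicator of $S_m\ge0$. The (signed) bias of $T$ is $\mathrm{bias}_T=\mathbb E[O^-_{I_T}-O_{I_T}]$. States: a with-hint state $u=\langle\ell,b,h\rangle$ with level $\ell\in[m]$ is the event $\{S_{m-\ell}=b,\ H_{m-\ell+1}=h\}$, and $u^-=\langle\ell,b\rangle$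 is the event $\{S_{m-\ell}=b\}$. A final state $\langle0,b\rangle$ is the event $\{S_m=b\}$; for it $u^-=u$ (so $c_u=v_u$, and "aborting" at a final state has no effect on the bias). $\widehat V$ is the set of all with-hint states and final states (of positive probability). $u<v$ means $u$ occurs in a strictly earlier round than $v$, i.e. the level of $u$ is strictly larger than that of $v$. For a state $u$, $c_u=\Pr[S_m\ge0\mid u^-]$ and $v_u=\Pr[S_m\ge 0\mid u]$. *)

theory Defs
  imports "HOL-Probability.Probability"
begin

section \<open>The online binomial game\<close>

definition coin_pmf :: "real \<Rightarrow> int pmf" where
  "coin_pmf \<epsilon> = map_pmf (\<lambda>x. if x then 1 else - 1) (bernoulli_pmf ((1 + \<epsilon>) / 2))"

definition coin_sum_pmf :: "nat \<Rightarrow> real \<Rightarrow> int pmf" where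
  "coin_sum_pmf n \<epsilon> = map_pmf (\<lambda>x. \<Sum>j<n. x j) (Pi_pmf {..<n} 0 (\<lambda>_. coin_pmf \<epsilon>))"

text \<open>A randomized function is given by the distribution of its value at each argument.\<close>

type_synonym 'h hint_fun = "nat \<Rightarrow> int \<Rightarrow> int \<Rightarrow> 'h pmf"

definition hint_function :: "nat \<Rightarrow> 'h hint_fun \<Rightarrow> bool" where
  "hint_function m f \<longleftrightarrow>
     (\<exists>A. finite A \<and> (\<forall>i\<in>{1..m}. \<forall>b c. set_pmf (f i b c) \<subseteq> A))"

text \<open>An outcome of the game consists of the coins \<open>C\<close> and the hints \<open>H\<close>, both indexed by the
  rounds \<open>1..m\<close>; the values at other indices are dummies.\<close>

type_synonym 'h outcome = "(nat \<Rightarrow> int) \<times> (nat \<Rightarrow> 'h)"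

definition psum :: "'h outcome \<Rightarrow> nat \<Rightarrow> int" where
  "psum \<omega> i = (\<Sum>j=1..i. fst \<omega> j)"

definition hint :: "'h outcome \<Rightarrow> nat \<Rightarrow> 'h" where
  "hint \<omega> i = snd \<omega> i"

definition game_pmf :: "nat \<Rightarrow> real \<Rightarrow> 'h hint_fun \<Rightarrow> 'h outcome pmf" where
  "game_pmf m \<epsilon> f =
     do {
       C \<leftarrow> Pi_pmf {1..m} 0 (\<lambda>i. coin_sum_pmf ((m - i + 1)\<^sup>2) \<epsilon>);
       H \<leftarrow> Pi_pmf {1..m} undefined (\<lambda>i. f i (\<Sum>j=1..i-1. C j) (C i));
       return_pmf (C, H)
     }"

definition delta :: "nat \<Rightarrow> real \<Rightarrow> 'h hint_fun \<Rightarrow> nat \<Rightarrow> int \<Rightarrow> real" where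
  "delta m \<epsilon> f i b =
     \<P>(\<omega> in game_pmf m \<epsilon> f. psum \<omega> m \<ge> 0 \<bar> psum \<omega> (i - 1) = b)"

definition delta_hint :: "nat \<Rightarrow> real \<Rightarrow> 'h hint_fun \<Rightarrow> nat \<Rightarrow> int \<Rightarrow> 'h \<Rightarrow> real" where
  "delta_hint m \<epsilon> f i b h =
     \<P>(\<omega> in game_pmf m \<epsilon> f. psum \<omega> m \<ge> 0 \<bar> psum \<omega> (i - 1) = b \<and> hint \<omega> i = h)"

text \<open>\<open>val_hint\<close> is $O_i$ and \<open>val_nohint\<close> is $O_i^-$.\<close>

definition val_hint :: "nat \<Rightarrow> real \<Rightarrow> 'h hint_fun \<Rightarrow> 'h outcome \<Rightarrow> nat \<Rightarrow> real" where
  "val_hint m \<epsilon> f \<omega> i =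
     (if i \<in> {1..m} then delta_hint m \<epsilon> f i (psum \<omega> (i - 1)) (hint \<omega> i)
      else of_bool (psum \<omega> m \<ge> 0))"

definition val_nohint :: "nat \<Rightarrow> real \<Rightarrow> 'h hint_fun \<Rightarrow> 'h outcome \<Rightarrow> nat \<Rightarrow> real" where
  "val_nohint m \<epsilon> f \<omega> i =
     (if i \<in> {1..m} then delta m \<epsilon> f i (psum \<omega> (i - 1))
      else of_bool (psum \<omega> m \<ge> 0))"

section \<open>Strategies\<close>

text \<open>A strategy has an internal state of type \<open>'s\<close>. In round \<open>i\<close> it maps its current internal
  state, $S_{i-1}$ and $H_i$ to a distribution over the output bit and the new internal state.\<close>

record ('s, 'h) strategy =
  strat_init :: "'s pmf"
  strat_step :: "nat \<Rightarrow> 's \<Rightarrow> int \<Rightarrow> 'h \<Rightarrow> (bool \<times> 's) pmf"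

primrec strat_run ::
  "('s, 'h) strategy \<Rightarrow> 'h outcome \<Rightarrow> nat \<Rightarrow> ('s \<times> (nat \<Rightarrow> bool)) pmf" where
  "strat_run T \<omega> 0 = map_pmf (\<lambda>s. (s, \<lambda>_. False)) (strat_init T)"
| "strat_run T \<omega> (Suc n) =
     do {
       (s, out) \<leftarrow> strat_run T \<omega> n;
       (x, s') \<leftarrow> strat_step T (Suc n) s (psum \<omega> n) (hint \<omega> (Suc n));
       return_pmf (s', out(Suc n := x))
     }"

definition abort_round :: "nat \<Rightarrow> (nat \<Rightarrow> bool) \<Rightarrow> nat" where
  "abort_round m out =
     (if \<exists>i\<in>{1..m}. out i then LEAST i. i \<in> {1..m} \<and> out i else m + 1)"

definition play_pmf ::
  "nat \<Rightarrow> real \<Rightarrow> 'h hint_fun \<Rightarrow> ('s, 'h) strategy \<Rightarrow> ('h outcome \<times> nat) pmf" where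
  "play_pmf m \<epsilon> f T =
     do {
       \<omega> \<leftarrow> game_pmf m \<epsilon> f;
       (s, out) \<leftarrow> strat_run T \<omega> m;
       return_pmf (\<omega>, abort_round m out)
     }"

definition bias :: "nat \<Rightarrow> real \<Rightarrow> 'h hint_fun \<Rightarrow> ('s, 'h) strategy \<Rightarrow> real" where
  "bias m \<epsilon> f T =
     measure_pmf.expectation (play_pmf m \<epsilon> f T)
       (\<lambda>(\<omega>, I). val_nohint m \<epsilon> f \<omega> I - val_hint m \<epsilon> f \<omega> I)"

section \<open>States and the linear program\<close>

datatype 'h state = HintState nat int 'h | FinalState int

fun level :: "'h state \<Rightarrow> nat" where
  "level (HintState l b h) = l"
| "level (FinalState b) = 0"

fun event :: "nat \<Rightarrow> 'h state \<Rightarrow> 'h outcome set" where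
  "event m (HintState l b h) = {\<omega>. psum \<omega> (m - l) = b \<and> hint \<omega> (m - l + 1) = h}"
| "event m (FinalState b) = {\<omega>. psum \<omega> m = b}"

text \<open>The event of $u^-$.\<close>

fun event_minus :: "nat \<Rightarrow> 'h state \<Rightarrow> 'h outcome set" where
  "event_minus m (HintState l b h) = {\<omega>. psum \<omega> (m - l) = b}"
| "event_minus m (FinalState b) = {\<omega>. psum \<omega> m = b}"

fun is_state :: "nat \<Rightarrow> 'h state \<Rightarrow> bool" where
  "is_state m (HintState l b h) \<longleftrightarrow> l \<in> {1..m}"
| "is_state m (FinalState b) \<longleftrightarrow> True"

definition prob_state :: "nat \<Rightarrow> real \<Rightarrow> 'h hint_fun \<Rightarrow> 'h state \<Rightarrow> real" where
  "prob_state m \<epsilon> f v = \<P>(\<omega> in game_pmf m \<epsilon> f. \<omega> \<in> event m v)"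

definition cprob_state :: "nat \<Rightarrow> real \<Rightarrow> 'h hint_fun \<Rightarrow> 'h state \<Rightarrow> 'h state \<Rightarrow> real" where
  "cprob_state m \<epsilon> f v u = \<P>(\<omega> in game_pmf m \<epsilon> f. \<omega> \<in> event m v \<bar> \<omega> \<in> event m u)"

definition states :: "nat \<Rightarrow> real \<Rightarrow> 'h hint_fun \<Rightarrow> 'h state set" where
  "states m \<epsilon> f = {u. is_state m u \<and> prob_state m \<epsilon> f u > 0}"

definition earlier :: "'h state \<Rightarrow> 'h state \<Rightarrow> bool" where
  "earlier u v \<longleftrightarrow> level v < level u"

definition c_state :: "nat \<Rightarrow> real \<Rightarrow> 'h hint_fun \<Rightarrow> 'h state \<Rightarrow> real" where
  "c_state m \<epsilon> f u = \<P>(\<omega> in game_pmf m \<epsilon> f. psum \<omega> m \<ge> 0 \<bar> \<omega> \<in> event_minus m u)"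

definition v_state :: "nat \<Rightarrow> real \<Rightarrow> 'h hint_fun \<Rightarrow> 'h state \<Rightarrow> real" where
  "v_state m \<epsilon> f u = \<P>(\<omega> in game_pmf m \<epsilon> f. psum \<omega> m \<ge> 0 \<bar> \<omega> \<in> event m u)"

definition lp_objective :: "nat \<Rightarrow> real \<Rightarrow> 'h hint_fun \<Rightarrow> ('h state \<Rightarrow> real) \<Rightarrow> real" where
  "lp_objective m \<epsilon> f a =
     (\<Sum>v\<in>states m \<epsilon> f. a v * (c_state m \<epsilon> f v - v_state m \<epsilon> f v))"

definition lp_feasible :: "nat \<Rightarrow> real \<Rightarrow> 'h hint_fun \<Rightarrow> ('h state \<Rightarrow> real) \<Rightarrow> bool" where
  "lp_feasible m \<epsilon> f a \<longleftrightarrow>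
     (\<forall>v\<in>states m \<epsilon> f.
        a v + (\<Sum>u\<in>{u \<in> states m \<epsilon> f. earlier u v}. a u * cprob_state m \<epsilon> f v u)
          \<le> prob_state m \<epsilon> f v) \<and>
     (\<forall>v\<in>states m \<epsilon> f. a v \<ge> 0)"

definition abort_prob ::
  "nat \<Rightarrow> real \<Rightarrow> 'h hint_fun \<Rightarrow> ('h state \<Rightarrow> real) \<Rightarrow> 'h state \<Rightarrow> real" where
  "abort_prob m \<epsilon> f a v =
     (let D = prob_state m \<epsilon> f v
            - (\<Sum>u\<in>{u \<in> states m \<epsilon> f. earlier u v}. a u * cprob_state m \<epsilon> f v u)
      in if D = 0 then 0 else a v / D)"

text \<open>The internal state records whether the strategy has already aborted. In round \<open>i\<close> the
  execution is at a with-hint state of level \<open>m - i + 1\<close>. There is no output at final states, which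
  are reached only after round \<open>m\<close>. Note that \<^const>\<open>bernoulli_pmf\<close> truncates its parameter to
  the unit interval, so that the abort probabilities lie there is a claim of its own.\<close>

definition lp_strategy ::
  "nat \<Rightarrow> real \<Rightarrow> 'h hint_fun \<Rightarrow> ('h state \<Rightarrow> real) \<Rightarrow> (bool, 'h) strategy" where
  "lp_strategy m \<epsilon> f a =
     \<lparr> strat_init = return_pmf False,
       strat_step = (\<lambda>i aborted b h.
         if aborted then return_pmf (False, True)
         else map_pmf (\<lambda>x. (x, x))
                (bernoulli_pmf (abort_prob m \<epsilon> f a (HintState (m - i + 1) b h)))) \<rparr>"

end

theory Submission
  imports Defs
begin

text \<open>
  Given $S_{j-1}$, the coins and hints of the rounds before \<open>j\<close> are independent of those from round
  \<open>j\<close> on. Hence whether the strategy is still active when it reaches a state \<open>u\<close> has no influence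
  on the probability of a later state \<open>v\<close> given \<open>u\<close>. By induction over the rounds, the strategy
  reaches \<open>v\<close> without having aborted with probability exactly
  $\Pr[v] - \sum_{u<v} a_u \Pr[v \mid u]$, so it aborts at \<open>v\<close> with probability $a_v$, and the
  formula for the bias follows by linearity of expectation.
\<close>

section \<open>Finite supports, first aborts and splitting of outcomes\<close>

lemma expectation_bind_finite:
  fixes h :: "'b \<Rightarrow> real"
  assumes "finite (set_pmf p)" "\<And>x. x \<in> set_pmf p \<Longrightarrow> finite (set_pmf (g x))"
  shows "measure_pmf.expectation (p \<bind> g) h =
    measure_pmf.expectation p (\<lambda>x. measure_pmf.expectation (g x) h)"
proof -
  have "measure_pmf.expectation (p \<bind> g) h =
      (\<Sum>a\<in>set_pmf p. pmf p a *\<^sub>R measure_pmf.expectation (g a) h)"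
    using assms by (intro pmf_expectation_bind) auto
  also have "\<dots> = measure_pmf.expectation p (\<lambda>x. measure_pmf.expectation (g x) h)"
    using assms by (subst integral_measure_pmf[of "set_pmf p"]) auto
  finally show ?thesis .
qed

lemma expectation_cong:
  fixes g h :: "'a \<Rightarrow> real"
  assumes "\<And>x. x \<in> set_pmf p \<Longrightarrow> g x = h x"
  shows "measure_pmf.expectation p g = measure_pmf.expectation p h"
  using assms by (intro integral_cong_AE) (auto simp: AE_measure_pmf_iff)

text \<open>With abort probability \<open>q k\<close> in round \<open>k\<close>, the
  \<open>j\<close>-th summand is the probability that the first abort happens in round
  \<open>j\<close>; the sum is the complement of never aborting.\<close>

lemma one_minus_prod:
  fixes q :: "nat \<Rightarrow> real"
  shows "(\<Prod>k\<in>{1..<Suc n}. 1 - q k) = 1 - (\<Sum>j\<in>{1..<Suc n}. q j * (\<Prod>k\<in>{1..<j}. 1 - q k))"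
proof (induction n)
  case (Suc n)
  have "{1..<Suc (Suc n)} = insert (Suc n) {1..<Suc n}"
    by auto
  with Suc show ?case
    by (simp add: algebra_simps)
qed simp

lemma finite_set_Pi_pmf:
  assumes "finite A" "\<And>x. x \<in> A \<Longrightarrow> finite (set_pmf (p x))"
  shows "finite (set_pmf (Pi_pmf A d p))"
  using assms by (subst set_Pi_pmf) (auto intro!: finite_PiE_dflt)

lemma finite_set_coin_sum_pmf: "finite (set_pmf (coin_sum_pmf n \<epsilon>))"
  unfolding coin_sum_pmf_def coin_pmf_def set_map_pmf
  by (intro finite_imageI finite_set_Pi_pmf) auto

text \<open>That a function depends only on the rounds in \<open>I\<close> is expressed as its
  invariance under \<open>agree_on I\<close>.\<close>

definition agree_on :: "nat set \<Rightarrow> 'h outcome \<Rightarrow> 'h outcome \<Rightarrow> bool" where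
  "agree_on I \<omega> \<omega>' \<longleftrightarrow> (\<forall>k\<in>I. fst \<omega> k = fst \<omega>' k \<and> snd \<omega> k = snd \<omega>' k)"

text \<open>The case distinction is that of \<open>Pi_pmf_union\<close>; dummy values outside the
  rounds come from the second outcome.\<close>

definition glue :: "nat \<Rightarrow> 'h outcome \<Rightarrow> 'h outcome \<Rightarrow> 'h outcome" where
  "glue j \<omega> \<omega>' = (\<lambda>k. if k \<in> {1..<j} then fst \<omega> k else fst \<omega>' k,
                 \<lambda>k. if k \<in> {1..<j} then snd \<omega> k else snd \<omega>' k)"

lemma psum_split:
  assumes "1 \<le> j" "j \<le> i + 1"
  shows "psum \<omega> i = psum \<omega> (j - 1) + (\<Sum>k=j..i. fst \<omega> k)"
proof -
  have "{1..i} = {1..j-1} \<union> {j..i}" using assms by auto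
  then show ?thesis
    unfolding psum_def using assms by (simp add: sum.union_disjoint)
qed

text \<open>Without an abort, \<open>abort_round n\<close> takes the value \<open>Suc n\<close>,
  which after one more round means a true abort. So the cases are told apart by the bits, not by
  this value.\<close>

lemma abort_round_Suc:
  "abort_round (Suc n) (out(Suc n := x)) =
     (if \<exists>i\<in>{1..n}. out i then abort_round n out else if x then Suc n else Suc (Suc n))"
proof (cases "\<exists>i\<in>{1..n}. out i")
  case True
  then obtain i where i: "i \<in> {1..n}" "out i" by auto
  define k where "k = (LEAST i. i \<in> {1..n} \<and> out i)"
  have k: "k \<in> {1..n} \<and> out k"
    unfolding k_def by (rule LeastI[of _ i]) (use i in auto)
  have "(LEAST i. i \<in> {1..Suc n} \<and> (out(Suc n := x)) i) = k"
  proof (rule Least_equality)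
    fix y assume y: "y \<in> {1..Suc n} \<and> (out(Suc n := x)) y"
    show "k \<le> y"
    proof (cases "y = Suc n")
      case False
      then show ?thesis unfolding k_def using y by (intro Least_le) auto
    qed (use k in auto)
  qed (use k in auto)
  moreover have "\<exists>i\<in>{1..Suc n}. (out(Suc n := x)) i"
    using i by (intro bexI[of _ i]) auto
  ultimately show ?thesis
    unfolding abort_round_def using True k_def by simp
next
  case False
  have "(LEAST i. i \<in> {1..Suc n} \<and> (out(Suc n := x)) i) = Suc n" if x
  proof (rule Least_equality)
    fix y assume y: "y \<in> {1..Suc n} \<and> (out(Suc n := x)) y"
    show "Suc n \<le> y"
      using y False by (cases "y = Suc n") auto
  qed (use that in auto)
  with False show ?thesis
    unfolding abort_round_def by (auto split: if_splits)
qed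

section \<open>The Markov property of the game\<close>

locale binomial_game =
  fixes m :: nat and \<epsilon> :: real and f :: "'h hint_fun"
  assumes hint_function: "hint_function m f"
begin

abbreviation game :: "'h outcome pmf" where
  "game \<equiv> game_pmf m \<epsilon> f"

abbreviation E :: "('h outcome \<Rightarrow> real) \<Rightarrow> real" where
  "E \<equiv> measure_pmf.expectation game"

definition head_pmf :: "nat \<Rightarrow> 'h outcome pmf" where
  "head_pmf j =
     do {
       C \<leftarrow> Pi_pmf {1..<j} 0 (\<lambda>i. coin_sum_pmf ((m - i + 1)\<^sup>2) \<epsilon>);
       H \<leftarrow> Pi_pmf {1..<j} undefined (\<lambda>i. f i (\<Sum>k=1..i-1. C k) (C i));
       return_pmf (C, H)
     }"

text \<open>The start value \<open>b\<close> stands for the partial sum after round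
  \<open>j - 1\<close>, the only trace of the earlier rounds in the later hints.\<close>

definition tail_pmf :: "nat \<Rightarrow> int \<Rightarrow> 'h outcome pmf" where
  "tail_pmf j b =
     do {
       C \<leftarrow> Pi_pmf {j..m} 0 (\<lambda>i. coin_sum_pmf ((m - i + 1)\<^sup>2) \<epsilon>);
       H \<leftarrow> Pi_pmf {j..m} undefined (\<lambda>i. f i (b + (\<Sum>k=j..i-1. C k)) (C i));
       return_pmf (C, H)
     }"

lemma finite_hints: "i \<in> {1..m} \<Longrightarrow> finite (set_pmf (f i b c))"
  using hint_function unfolding hint_function_def by (meson finite_subset)

lemma finite_game: "finite (set_pmf game)"
  unfolding game_pmf_def set_bind_pmf
  by (intro finite_UN_I finite_set_Pi_pmf finite_set_coin_sum_pmf finite_hints) auto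

lemma finite_head: "j \<le> m \<Longrightarrow> finite (set_pmf (head_pmf j))"
  unfolding head_pmf_def set_bind_pmf
  by (intro finite_UN_I finite_set_Pi_pmf finite_set_coin_sum_pmf finite_hints) auto

lemma finite_tail: "1 \<le> j \<Longrightarrow> finite (set_pmf (tail_pmf j b))"
  unfolding tail_pmf_def set_bind_pmf
  by (intro finite_UN_I finite_set_Pi_pmf finite_set_coin_sum_pmf finite_hints) auto

lemma integrable_game [simp]: "integrable (measure_pmf game) (g :: _ \<Rightarrow> real)"
  by (rule integrable_measure_pmf_finite[OF finite_game])

text \<open>Product distributions split at round \<open>j\<close>. The coins from round
  \<open>j\<close> on can be drawn after the earlier hints, which do not involve them.\<close>

lemma game_split:
  assumes "j \<in> {1..m}"
  shows "game = head_pmf j \<bind> (\<lambda>\<omega>. map_pmf (glue j \<omega>) (tail_pmf j (psum \<omega> (j - 1))))"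
proof -
  let ?A = "{1..<j}" and ?B = "{j..m}"
  let ?coin = "\<lambda>i. coin_sum_pmf ((m - i + 1)\<^sup>2) \<epsilon>"
  let ?C = "\<lambda>(C1 :: nat \<Rightarrow> int) C2 k. if k \<in> ?A then C1 k else C2 k"
  let ?H = "\<lambda>(H1 :: nat \<Rightarrow> 'h) H2 k. if k \<in> ?A then H1 k else H2 k"
  have AB: "{1..m} = ?A \<union> ?B" using assms by auto
  have union: "Pi_pmf {1..m} d p = map_pmf (\<lambda>(g, h) k. if k \<in> ?A then g k else h k)
      (pair_pmf (Pi_pmf ?A d p) (Pi_pmf ?B d p))" for d :: 'c and p
    unfolding AB by (rule Pi_pmf_union) auto
  have hints: "Pi_pmf {1..m} undefined (\<lambda>i. f i (\<Sum>k=1..i-1. ?C C1 C2 k) (?C C1 C2 i)) =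
     Pi_pmf ?A undefined (\<lambda>i. f i (\<Sum>k=1..i-1. C1 k) (C1 i)) \<bind> (\<lambda>H1.
     Pi_pmf ?B undefined (\<lambda>i. f i ((\<Sum>k=1..j-1. C1 k) + (\<Sum>k=j..i-1. C2 k)) (C2 i)) \<bind> (\<lambda>H2.
     return_pmf (?H H1 H2)))" for C1 C2
  proof -
    have *: "Pi_pmf ?A undefined (\<lambda>i. f i (\<Sum>k=1..i-1. ?C C1 C2 k) (?C C1 C2 i)) =
        Pi_pmf ?A undefined (\<lambda>i. f i (\<Sum>k=1..i-1. C1 k) (C1 i))"
    proof (intro Pi_pmf_cong refl)
      fix i assume i: "i \<in> ?A"
      then have "(\<Sum>k=1..i-1. ?C C1 C2 k) = (\<Sum>k=1..i-1. C1 k)"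
        by (intro sum.cong) auto
      with i show "f i (\<Sum>k=1..i-1. ?C C1 C2 k) (?C C1 C2 i) = f i (\<Sum>k=1..i-1. C1 k) (C1 i)"
        by simp
    qed
    \<comment> \<open>A later hint sees the earlier coins only through their sum.\<close>
    have **: "Pi_pmf ?B undefined (\<lambda>i. f i (\<Sum>k=1..i-1. ?C C1 C2 k) (?C C1 C2 i)) =
        Pi_pmf ?B undefined (\<lambda>i. f i ((\<Sum>k=1..j-1. C1 k) + (\<Sum>k=j..i-1. C2 k)) (C2 i))"
    proof (intro Pi_pmf_cong refl)
      fix i assume i: "i \<in> ?B"
      \<comment> \<open>\<open>psum\<close> reads only the coins, so any hint component serves to
        apply \<open>psum_split\<close>.\<close>
      have "(\<Sum>k=1..i-1. ?C C1 C2 k) = (\<Sum>k=1..j-1. ?C C1 C2 k) + (\<Sum>k=j..i-1. ?C C1 C2 k)"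
        using psum_split[of j "i - 1" "(?C C1 C2, undefined)"] i assms by (simp add: psum_def)
      also have "(\<Sum>k=1..j-1. ?C C1 C2 k) = (\<Sum>k=1..j-1. C1 k)"
        by (intro sum.cong) auto
      also have "(\<Sum>k=j..i-1. ?C C1 C2 k) = (\<Sum>k=j..i-1. C2 k)"
        by (intro sum.cong) auto
      finally show "f i (\<Sum>k=1..i-1. ?C C1 C2 k) (?C C1 C2 i) =
          f i ((\<Sum>k=1..j-1. C1 k) + (\<Sum>k=j..i-1. C2 k)) (C2 i)"
        using i by simp
    qed
    show ?thesis
      unfolding union * **
      by (simp add: map_pmf_def pair_pmf_def bind_assoc_pmf bind_return_pmf)
  qed
  have "game = Pi_pmf ?A 0 ?coin \<bind> (\<lambda>C1. Pi_pmf ?B 0 ?coin \<bind> (\<lambda>C2.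
     Pi_pmf {1..m} undefined (\<lambda>i. f i (\<Sum>k=1..i-1. ?C C1 C2 k) (?C C1 C2 i)) \<bind> (\<lambda>H.
     return_pmf (?C C1 C2, H))))"
    unfolding game_pmf_def
    by (subst (1) AB, subst Pi_pmf_union)
      (auto simp: map_pmf_def pair_pmf_def bind_assoc_pmf bind_return_pmf)
  also have "\<dots> = Pi_pmf ?A 0 ?coin \<bind> (\<lambda>C1. Pi_pmf ?B 0 ?coin \<bind> (\<lambda>C2.
     Pi_pmf ?A undefined (\<lambda>i. f i (\<Sum>k=1..i-1. C1 k) (C1 i)) \<bind> (\<lambda>H1.
     Pi_pmf ?B undefined (\<lambda>i. f i ((\<Sum>k=1..j-1. C1 k) + (\<Sum>k=j..i-1. C2 k)) (C2 i)) \<bind> (\<lambda>H2.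
     return_pmf (?C C1 C2, ?H H1 H2)))))"
    unfolding hints by (simp add: bind_assoc_pmf bind_return_pmf)
  also have "\<dots> = Pi_pmf ?A 0 ?coin \<bind> (\<lambda>C1.
     Pi_pmf ?A undefined (\<lambda>i. f i (\<Sum>k=1..i-1. C1 k) (C1 i)) \<bind> (\<lambda>H1.
     Pi_pmf ?B 0 ?coin \<bind> (\<lambda>C2.
     Pi_pmf ?B undefined (\<lambda>i. f i ((\<Sum>k=1..j-1. C1 k) + (\<Sum>k=j..i-1. C2 k)) (C2 i)) \<bind> (\<lambda>H2.
     return_pmf (?C C1 C2, ?H H1 H2)))))"
    by (subst bind_commute_pmf) simp
  also have "\<dots> = head_pmf j \<bind> (\<lambda>\<omega>. map_pmf (glue j \<omega>) (tail_pmf j (psum \<omega> (j - 1))))"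
    by (simp add: head_pmf_def tail_pmf_def map_pmf_def bind_assoc_pmf bind_return_pmf
        psum_def glue_def cong del: if_weak_cong)
  finally show ?thesis .
qed

text \<open>The Markov property: the factor \<open>K\<close> contributed by the rounds from \<open>j\<close> on does not depend
  on the function \<open>\<phi>\<close> of the rounds before \<open>j\<close>.\<close>

lemma markov_kernel:
  assumes j: "j \<in> {1..m}"
    and F: "\<And>\<omega> \<omega>'. psum \<omega> (j - 1) = psum \<omega>' (j - 1) \<Longrightarrow> agree_on {j..m} \<omega> \<omega>' \<Longrightarrow> F \<omega> = F \<omega>'"
  shows "\<exists>K. \<forall>\<phi>. (\<forall>\<omega> \<omega>'. agree_on {1..<j} \<omega> \<omega>' \<longrightarrow> \<phi> \<omega> = \<phi> \<omega>') \<longrightarrow>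
     E (\<lambda>\<omega>. \<phi> \<omega> * of_bool (psum \<omega> (j - 1) = b) * F \<omega>) =
     E (\<lambda>\<omega>. \<phi> \<omega> * of_bool (psum \<omega> (j - 1) = b)) * K"
proof (cases "\<exists>\<omega> :: 'h outcome. psum \<omega> (j - 1) = b")
  case True
  \<comment> \<open>The outcome \<open>\<omega>0\<close> only supplies a prefix with the right sum
    and may have probability 0. No such prefix exists just when \<open>j = 1\<close> and
    \<open>b \<noteq> 0\<close>; then both sides vanish.\<close>
  then obtain \<omega>0 :: "'h outcome" where \<omega>0: "psum \<omega>0 (j - 1) = b" by auto
  have psum_glue: "psum (glue j \<omega> \<omega>') (j - 1) = psum \<omega> (j - 1)" for \<omega> \<omega>' :: "'h outcome"
    unfolding psum_def glue_def by (auto intro!: sum.cong)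
  define X where "X = (\<lambda>\<phi>. measure_pmf.expectation (head_pmf j)
     (\<lambda>\<omega>. \<phi> \<omega> * of_bool (psum \<omega> (j - 1) = b) :: real))"
  \<comment> \<open>Taking \<open>F' = 1\<close> as well as \<open>F' = F\<close> later expresses
    \<open>X \<phi>\<close> as an expectation over the whole game.\<close>
  have key: "E (\<lambda>\<omega>. \<phi> \<omega> * of_bool (psum \<omega> (j - 1) = b) * F' \<omega>) =
      X \<phi> * measure_pmf.expectation (tail_pmf j b) (\<lambda>\<omega>'. F' (glue j \<omega>0 \<omega>'))"
    if \<phi>: "\<And>\<omega> \<omega>'. agree_on {1..<j} \<omega> \<omega>' \<Longrightarrow> \<phi> \<omega> = \<phi> \<omega>'"
      and F': "\<And>\<omega> \<omega>'. psum \<omega> (j - 1) = psum \<omega>' (j - 1) \<Longrightarrow> agree_on {j..m} \<omega> \<omega>' \<Longrightarrow> F' \<omega> = F' \<omega>'"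
    for \<phi> F' :: "'h outcome \<Rightarrow> real"
  proof -
    have 1: "\<phi> (glue j \<omega> \<omega>') = \<phi> \<omega>" for \<omega> \<omega>'
      by (rule \<phi>) (auto simp: agree_on_def glue_def)
    \<comment> \<open>Once the partial sum is fixed, the true prefix may be replaced by that of
      \<open>\<omega>0\<close>.\<close>
    have 2: "F' (glue j \<omega> \<omega>') = F' (glue j \<omega>0 \<omega>')" if "psum \<omega> (j - 1) = b" for \<omega> \<omega>'
      by (rule F') (simp only: psum_glue that \<omega>0, auto simp: agree_on_def glue_def)
    have "E (\<lambda>\<omega>. \<phi> \<omega> * of_bool (psum \<omega> (j - 1) = b) * F' \<omega>) =
      measure_pmf.expectation (head_pmf j) (\<lambda>\<omega>.
        measure_pmf.expectation (tail_pmf j (psum \<omega> (j - 1)))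
          (\<lambda>\<omega>'. \<phi> \<omega> * of_bool (psum \<omega> (j - 1) = b) * F' (glue j \<omega> \<omega>')))"
      unfolding game_split[OF j] using j
      by (subst expectation_bind_finite) (auto simp: finite_head finite_tail psum_glue[unfolded One_nat_def] 1)
    also have "\<dots> = measure_pmf.expectation (head_pmf j) (\<lambda>\<omega>.
        (\<phi> \<omega> * of_bool (psum \<omega> (j - 1) = b)) *
        measure_pmf.expectation (tail_pmf j b) (\<lambda>\<omega>'. F' (glue j \<omega>0 \<omega>')))"
      by (intro expectation_cong) (auto simp: 2)
    also have "\<dots> = X \<phi> * measure_pmf.expectation (tail_pmf j b) (\<lambda>\<omega>'. F' (glue j \<omega>0 \<omega>'))"
      unfolding X_def by simp
    finally show ?thesis .
  qed
  show ?thesis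
  proof (intro exI allI impI)
    fix \<phi> :: "'h outcome \<Rightarrow> real"
    assume \<phi>: "\<forall>\<omega> \<omega>'. agree_on {1..<j} \<omega> \<omega>' \<longrightarrow> \<phi> \<omega> = \<phi> \<omega>'"
    have "E (\<lambda>\<omega>. \<phi> \<omega> * of_bool (psum \<omega> (j - 1) = b)) = X \<phi>"
      using key[of \<phi> "\<lambda>_. 1"] \<phi> by simp
    then show "E (\<lambda>\<omega>. \<phi> \<omega> * of_bool (psum \<omega> (j - 1) = b) * F \<omega>) =
        E (\<lambda>\<omega>. \<phi> \<omega> * of_bool (psum \<omega> (j - 1) = b)) *
        measure_pmf.expectation (tail_pmf j b) (\<lambda>\<omega>'. F (glue j \<omega>0 \<omega>'))"
      using key[of \<phi> F] \<phi> F by simp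
  qed
next
  case False
  then have "psum \<omega> (j - 1) \<noteq> b" for \<omega> :: "'h outcome"
    by blast
  then show ?thesis by simp
qed

section \<open>States, grouped by rounds\<close>

definition state_at :: "nat \<Rightarrow> 'h outcome \<Rightarrow> 'h state" where
  "state_at i \<omega> = HintState (m - i + 1) (psum \<omega> (i - 1)) (hint \<omega> i)"

text \<open>As \<open>m - i + 1\<close> is never 0, final states lie in no layer. For
  \<open>i > m\<close> truncated subtraction makes \<open>layer i\<close> equal to
  \<open>layer m\<close>, so disjointness asks for indices in \<open>{1..m}\<close>.\<close>

definition layer :: "nat \<Rightarrow> 'h state set" where
  "layer i = {u \<in> states m \<epsilon> f. level u = m - i + 1}"

lemma prob_state_eq: "prob_state m \<epsilon> f v = E (\<lambda>\<omega>. of_bool (\<omega> \<in> event m v))"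
proof -
  have "prob_state m \<epsilon> f v = E (indicator (event m v))"
    unfolding prob_state_def by simp
  also have "\<dots> = E (\<lambda>\<omega>. of_bool (\<omega> \<in> event m v))"
    by (intro expectation_cong) (auto simp: indicator_def)
  finally show ?thesis .
qed

lemma cprob_state_eq:
  "cprob_state m \<epsilon> f v u =
     E (\<lambda>\<omega>. of_bool (\<omega> \<in> event m u) * of_bool (\<omega> \<in> event m v)) / prob_state m \<epsilon> f u"
proof -
  have "cprob_state m \<epsilon> f v u = E (indicator (event m v \<inter> event m u)) / prob_state m \<epsilon> f u"
    unfolding cprob_state_def cond_prob_def prob_state_def by (simp add: Int_def)
  also have "E (indicator (event m v \<inter> event m u)) =
      E (\<lambda>\<omega>. of_bool (\<omega> \<in> event m u) * of_bool (\<omega> \<in> event m v))"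
    by (intro expectation_cong) (auto simp: indicator_def)
  finally show ?thesis .
qed

lemma prob_state_pos_iff: "prob_state m \<epsilon> f v > 0 \<longleftrightarrow> (\<exists>\<omega>\<in>set_pmf game. \<omega> \<in> event m v)"
proof -
  have "prob_state m \<epsilon> f v > 0 \<longleftrightarrow> measure_pmf.prob game (event m v) \<noteq> 0"
    unfolding prob_state_def using zero_less_measure_iff by simp
  also have "\<dots> \<longleftrightarrow> (\<exists>\<omega>\<in>set_pmf game. \<omega> \<in> event m v)"
    by (auto simp: measure_pmf_zero_iff)
  finally show ?thesis .
qed

lemma layer_cases:
  assumes "u \<in> layer i" "i \<in> {1..m}"
  obtains b h where "u = HintState (m - i + 1) b h"
    "event m u = {\<omega>. psum \<omega> (i - 1) = b \<and> hint \<omega> i = h}"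
  using assms by (cases u) (auto simp: layer_def)

lemma layer_event:
  assumes "u \<in> layer i" "i \<in> {1..m}"
  shows "\<omega> \<in> event m u \<longleftrightarrow> state_at i \<omega> = u"
  using assms by (elim layer_cases) (auto simp: state_at_def)

lemma state_at_in_layer:
  assumes "\<omega> \<in> set_pmf game" "i \<in> {1..m}"
  shows "state_at i \<omega> \<in> layer i"
proof -
  have "\<omega> \<in> event m (state_at i \<omega>)" using assms by (auto simp: state_at_def)
  then have "prob_state m \<epsilon> f (state_at i \<omega>) > 0"
    using assms prob_state_pos_iff by blast
  then show ?thesis using assms by (auto simp: layer_def states_def state_at_def)
qed

text \<open>Each state of positive probability is passed by one of the finitely many outcomes in the
  support.\<close>

lemma finite_states: "finite (states m \<epsilon> f)"
proof (rule finite_subset)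
  show "states m \<epsilon> f \<subseteq> (\<Union>i\<in>{1..m}. state_at i ` set_pmf game) \<union>
      (\<lambda>\<omega>. FinalState (psum \<omega> m)) ` set_pmf game"
  proof
    fix u assume u: "u \<in> states m \<epsilon> f"
    then obtain \<omega> where \<omega>: "\<omega> \<in> set_pmf game" "\<omega> \<in> event m u"
      unfolding states_def using prob_state_pos_iff by blast
    show "u \<in> (\<Union>i\<in>{1..m}. state_at i ` set_pmf game) \<union>
        (\<lambda>\<omega>. FinalState (psum \<omega> m)) ` set_pmf game"
    proof (cases u)
      case (HintState l b h)
      then have "l \<in> {1..m}" using u by (simp add: states_def)
      then have "u = state_at (m - l + 1) \<omega>" "m - l + 1 \<in> {1..m}"
        using \<omega> HintState by (auto simp: state_at_def)
      then show ?thesis using \<omega> by blast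
    qed (use \<omega> in auto)
  qed
qed (use finite_game in auto)

lemma finite_layer: "finite (layer i)"
  unfolding layer_def using finite_states by simp

text \<open>An outcome in the support passes exactly one state of the layer. This turns a function
  of the current state into a combination of indicators, to which linearity of expectation
  applies.\<close>

lemma sum_layer:
  assumes "\<omega> \<in> set_pmf game" "i \<in> {1..m}"
  shows "g (state_at i \<omega>) = (\<Sum>u\<in>layer i. of_bool (\<omega> \<in> event m u) * (g u :: real))"
proof -
  have "(\<Sum>u\<in>layer i. of_bool (\<omega> \<in> event m u) * g u) =
      (\<Sum>u\<in>layer i. if u = state_at i \<omega> then g u else 0)"
    using assms by (intro sum.cong) (auto simp: layer_event)
  also have "\<dots> = g (state_at i \<omega>)"
    using assms finite_layer state_at_in_layer by simp
  finally show ?thesis by simp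
qed

text \<open>Higher levels belong to earlier rounds. Final states have level 0 and so precede
  nothing.\<close>

lemma earlier_layers:
  assumes "v \<in> layer i" "i \<in> {1..m}"
  shows "{u \<in> states m \<epsilon> f. earlier u v} = (\<Union>j\<in>{1..<i}. layer j)"
proof (intro set_eqI iffI)
  fix u assume u: "u \<in> {u \<in> states m \<epsilon> f. earlier u v}"
  have "level u \<le> m" using u by (cases u) (auto simp: states_def)
  then have "u \<in> layer (m - level u + 1)" "m - level u + 1 \<in> {1..<i}"
    using u assms by (auto simp: layer_def earlier_def)
  then show "u \<in> (\<Union>j\<in>{1..<i}. layer j)" by blast
qed (use assms in \<open>auto simp: layer_def earlier_def\<close>)

lemma layer_disjoint: "i \<in> {1..m} \<Longrightarrow> j \<in> {1..m} \<Longrightarrow> i \<noteq> j \<Longrightarrow> layer i \<inter> layer j = {}"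
  by (auto simp: layer_def)

text \<open>By the Markov property at round \<open>j\<close>, both expectations are the same
  functional of \<open>\<phi>\<close> times a constant; the ratio of the constants is found with
  \<open>\<phi> = 1\<close>. The later use is with \<open>\<phi> = survival j\<close>.\<close>

lemma markov_states:
  assumes u: "u \<in> layer j" "j \<in> {1..m}" and v: "v \<in> layer i" "i \<in> {j<..m}"
    and \<phi>: "\<And>\<omega> \<omega>'. agree_on {1..<j} \<omega> \<omega>' \<Longrightarrow> \<phi> \<omega> = \<phi> \<omega>'"
  shows "E (\<lambda>\<omega>. of_bool (\<omega> \<in> event m u) * of_bool (\<omega> \<in> event m v) * \<phi> \<omega>) =
    E (\<lambda>\<omega>. of_bool (\<omega> \<in> event m u) * \<phi> \<omega>) * cprob_state m \<epsilon> f v u"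
proof -
  obtain b h where eu: "event m u = {\<omega>. psum \<omega> (j - 1) = b \<and> hint \<omega> j = h}"
    using u by (rule layer_cases)
  have "i \<in> {1..m}" using v by auto
  then obtain b' h' where ev: "event m v = {\<omega>. psum \<omega> (i - 1) = b' \<and> hint \<omega> i = h'}"
    using v(1) by (auto elim: layer_cases)
  \<comment> \<open>The sum condition of \<open>u\<close> is the indicator already present in
    \<open>markov_kernel\<close>. What is left of \<open>u\<close>, and of \<open>u\<close> together
    with \<open>v\<close>, depends, given this sum, only on the rounds from \<open>j\<close>
    on.\<close>
  let ?F = "\<lambda>\<omega>. of_bool (hint \<omega> j = h) :: real"
  let ?F' = "\<lambda>\<omega>. of_bool (hint \<omega> j = h \<and> \<omega> \<in> event m v) :: real"
  have F: "?F \<omega> = ?F \<omega>'" if "agree_on {j..m} \<omega> \<omega>'" for \<omega> \<omega>'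
    using that u by (auto simp: agree_on_def hint_def)
  have F': "?F' \<omega> = ?F' \<omega>'"
    if "psum \<omega> (j - 1) = psum \<omega>' (j - 1)" "agree_on {j..m} \<omega> \<omega>'" for \<omega> \<omega>'
  proof -
    have "(\<Sum>k=j..i-1. fst \<omega> k) = (\<Sum>k=j..i-1. fst \<omega>' k)"
      using that v by (intro sum.cong) (auto simp: agree_on_def)
    then have "psum \<omega> (i - 1) = psum \<omega>' (i - 1)"
      using psum_split[of j "i - 1" \<omega>] psum_split[of j "i - 1" \<omega>'] that u v by simp
    then show ?thesis
      using that u v by (auto simp: ev agree_on_def hint_def)
  qed
  from markov_kernel[of j ?F b, OF u(2) F] obtain K where K:
    "\<And>\<phi>. (\<forall>\<omega> \<omega>'. agree_on {1..<j} \<omega> \<omega>' \<longrightarrow> \<phi> \<omega> = \<phi> \<omega>') \<Longrightarrow>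
     E (\<lambda>\<omega>. \<phi> \<omega> * of_bool (psum \<omega> (j - 1) = b) * ?F \<omega>) =
     E (\<lambda>\<omega>. \<phi> \<omega> * of_bool (psum \<omega> (j - 1) = b)) * K"
    by blast
  from markov_kernel[of j ?F' b, OF u(2) F'] obtain K' where K':
    "\<And>\<phi>. (\<forall>\<omega> \<omega>'. agree_on {1..<j} \<omega> \<omega>' \<longrightarrow> \<phi> \<omega> = \<phi> \<omega>') \<Longrightarrow>
     E (\<lambda>\<omega>. \<phi> \<omega> * of_bool (psum \<omega> (j - 1) = b) * ?F' \<omega>) =
     E (\<lambda>\<omega>. \<phi> \<omega> * of_bool (psum \<omega> (j - 1) = b)) * K'"
    by blast
  define s where "s = (\<lambda>\<phi>. E (\<lambda>\<omega>. \<phi> \<omega> * of_bool (psum \<omega> (j - 1) = b)))"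
  have 1: "E (\<lambda>\<omega>. of_bool (\<omega> \<in> event m u) * \<psi> \<omega>) = s \<psi> * K"
    if "\<forall>\<omega> \<omega>'. agree_on {1..<j} \<omega> \<omega>' \<longrightarrow> \<psi> \<omega> = \<psi> \<omega>'" for \<psi>
    unfolding s_def K[OF that, symmetric] by (intro expectation_cong) (auto simp: eu)
  have 2: "E (\<lambda>\<omega>. of_bool (\<omega> \<in> event m u) * of_bool (\<omega> \<in> event m v) * \<psi> \<omega>) = s \<psi> * K'"
    if "\<forall>\<omega> \<omega>'. agree_on {1..<j} \<omega> \<omega>' \<longrightarrow> \<psi> \<omega> = \<psi> \<omega>'" for \<psi>
    unfolding s_def K'[OF that, symmetric] by (intro expectation_cong) (auto simp: eu)
  have Pu: "prob_state m \<epsilon> f u = s (\<lambda>_. 1) * K"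
    using 1[of "\<lambda>_. 1"] by (simp add: prob_state_eq)
  have "prob_state m \<epsilon> f u > 0"
    using u by (simp add: layer_def states_def)
  then have "s (\<lambda>_. 1) \<noteq> 0" "K \<noteq> 0"
    using Pu by auto
  then show ?thesis
    unfolding cprob_state_eq using 1[of \<phi>] 2[of \<phi>] 2[of "\<lambda>_. 1"] \<phi> Pu
    by (simp add: field_simps)
qed

end

section \<open>Feasible solutions and abort probabilities\<close>

locale lp_solution = binomial_game m \<epsilon> f
  for m :: nat and \<epsilon> :: real and f :: "'h hint_fun" +
  fixes a :: "'h state \<Rightarrow> real"
  assumes feasible: "lp_feasible m \<epsilon> f a"
begin

text \<open>For a with-hint state, \<open>residual v\<close> turns out to be the probability that the strategy reaches
  \<open>v\<close> without having aborted before (\<open>reach_prob\<close>).\<close>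

definition residual :: "'h state \<Rightarrow> real" where
  "residual v = prob_state m \<epsilon> f v -
     (\<Sum>u\<in>{u \<in> states m \<epsilon> f. earlier u v}. a u * cprob_state m \<epsilon> f v u)"

lemma a_bounds: "v \<in> states m \<epsilon> f \<Longrightarrow> 0 \<le> a v \<and> a v \<le> residual v"
  using feasible by (auto simp: lp_feasible_def residual_def algebra_simps)

lemma abort_prob_residual:
  "abort_prob m \<epsilon> f a v = (if residual v = 0 then 0 else a v / residual v)"
  by (simp add: abort_prob_def residual_def Let_def)

text \<open>Feasibility says that the numerator lies between 0 and the denominator.\<close>

lemma abort_prob_bounds: "v \<in> states m \<epsilon> f \<Longrightarrow> abort_prob m \<epsilon> f a v \<in> {0..1}"
  using a_bounds[of v] by (auto simp: abort_prob_residual)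

text \<open>Where the residual is 0, feasibility forces \<open>a v = 0\<close>, so the convention
  for a zero denominator is consistent.\<close>

lemma abort_prob_times_residual:
  "v \<in> states m \<epsilon> f \<Longrightarrow> abort_prob m \<epsilon> f a v * residual v = a v"
  using a_bounds[of v] by (auto simp: abort_prob_residual)

text \<open>The chance that a still active strategy aborts in round \<open>i\<close>.\<close>

definition q :: "nat \<Rightarrow> 'h outcome \<Rightarrow> real" where
  "q i \<omega> = abort_prob m \<epsilon> f a (state_at i \<omega>)"

text \<open>The probability, over the strategy's own randomness, of no abort before round \<open>i\<close> when the
  outcome of the game is \<open>\<omega>\<close>.\<close>

definition survival :: "nat \<Rightarrow> 'h outcome \<Rightarrow> real" where
  "survival i \<omega> = (\<Prod>k\<in>{1..<i}. 1 - q k \<omega>)"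

lemma q_bounds: "\<omega> \<in> set_pmf game \<Longrightarrow> i \<in> {1..m} \<Longrightarrow> q i \<omega> \<in> {0..1}"
  unfolding q_def using abort_prob_bounds state_at_in_layer by (simp add: layer_def)

text \<open>The states of the rounds before \<open>j\<close> are read off from those rounds alone;
  this makes \<open>survival j\<close> a legitimate \<open>\<phi>\<close> in
  \<open>markov_states\<close>.\<close>

lemma survival_cong:
  assumes "agree_on {1..<j} \<omega> \<omega>'"
  shows "survival j \<omega> = survival j \<omega>'"
  unfolding survival_def
proof (rule prod.cong)
  fix k assume k: "k \<in> {1..<j}"
  have "psum \<omega> (k - 1) = psum \<omega>' (k - 1)"
    unfolding psum_def using k assms by (intro sum.cong) (auto simp: agree_on_def)
  then show "1 - q k \<omega> = 1 - q k \<omega>'"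
    using k assms by (simp add: q_def state_at_def hint_def agree_on_def)
qed simp

section \<open>Abort and reach probabilities\<close>

abbreviation T :: "(bool, 'h) strategy" where
  "T \<equiv> lp_strategy m \<epsilon> f a"

lemma finite_step: "finite (set_pmf (strat_step T i s b h))"
  by (auto simp: lp_strategy_def)

lemma finite_run: "finite (set_pmf (strat_run T \<omega> n))"
proof (induction n)
  case (Suc n)
  then show ?case
    by (auto simp: set_bind_pmf case_prod_unfold intro!: finite_UN_I finite_step)
qed (simp add: lp_strategy_def)

text \<open>The internal state turns True with the first abort and stays so. This links it to the
  case distinction in \<open>abort_round_Suc\<close>.\<close>

lemma run_aborted_iff:
  assumes "(s, out) \<in> set_pmf (strat_run T \<omega> n)"
  shows "s \<longleftrightarrow> (\<exists>i\<in>{1..n}. out i)"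
  using assms
proof (induction n arbitrary: s out)
  case (Suc n)
  then obtain s' out' x where *: "(s', out') \<in> set_pmf (strat_run T \<omega> n)"
    "(x, s) \<in> set_pmf (strat_step T (Suc n) s' (psum \<omega> n) (hint \<omega> (Suc n)))"
    "out = out'(Suc n := x)"
    by auto
  have "s \<longleftrightarrow> s' \<or> x"
    using *(2) by (auto simp: lp_strategy_def split: if_splits)
  moreover have "(\<exists>i\<in>{1..Suc n}. out i) \<longleftrightarrow> (\<exists>i\<in>{1..n}. out' i) \<or> x"
    by (auto simp: *(3) atLeastAtMostSuc_conv)
  ultimately show ?case
    using Suc.IH[OF *(1)] by simp
qed (auto simp: lp_strategy_def)

text \<open>For a fixed outcome the first abort falls in round \<open>i\<close> with probability
  \<open>q i \<omega> * survival i \<omega>\<close>. The bounds on \<open>q\<close> keep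
  \<open>bernoulli_pmf\<close> from truncating, and \<open>g\<close> also sees the internal state
  because the induction hypothesis is used with a function that depends on it.\<close>

lemma run_expectation:
  fixes g :: "bool \<Rightarrow> nat \<Rightarrow> real"
  assumes "\<And>i. i \<in> {1..n} \<Longrightarrow> q i \<omega> \<in> {0..1}"
  shows "measure_pmf.expectation (strat_run T \<omega> n) (\<lambda>(s, out). g s (abort_round n out)) =
    (\<Sum>i=1..n. q i \<omega> * survival i \<omega> * g True i) + survival (n + 1) \<omega> * g False (n + 1)"
  using assms
proof (induction n arbitrary: g)
  case 0
  then show ?case by (simp add: lp_strategy_def abort_round_def survival_def)
next
  case (Suc n)
  let ?q = "q (Suc n) \<omega>"
  \<comment> \<open>The value after averaging over round \<open>Suc n\<close>: settled if an abort
    occurred before, otherwise a coin toss with abort probability \<open>?q\<close>.\<close>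
  let ?g = "\<lambda>s i. if s then g True i
    else ?q * g True (Suc n) + (1 - ?q) * g False (Suc (Suc n))"
  have q: "0 \<le> ?q" "?q \<le> 1"
    using Suc.prems[of "Suc n"] by auto
  have "measure_pmf.expectation (strat_run T \<omega> (Suc n)) (\<lambda>(s, out). g s (abort_round (Suc n) out)) =
    measure_pmf.expectation (strat_run T \<omega> n) (\<lambda>(s, out).
      measure_pmf.expectation (strat_step T (Suc n) s (psum \<omega> n) (hint \<omega> (Suc n)))
        (\<lambda>(x, s'). g s' (abort_round (Suc n) (out(Suc n := x)))))"
    by (simp add: expectation_bind_finite finite_run finite_step case_prod_unfold)
  also have "\<dots> = measure_pmf.expectation (strat_run T \<omega> n) (\<lambda>(s, out). ?g s (abort_round n out))"
  proof (rule expectation_cong, clarify)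
    fix s out assume "(s, out) \<in> set_pmf (strat_run T \<omega> n)"
    then have s: "s \<longleftrightarrow> (\<exists>i\<in>{1..n}. out i)"
      by (rule run_aborted_iff)
    show "measure_pmf.expectation (strat_step T (Suc n) s (psum \<omega> n) (hint \<omega> (Suc n)))
        (\<lambda>(x, s'). g s' (abort_round (Suc n) (out(Suc n := x)))) = ?g s (abort_round n out)"
    proof (cases s)
      case True
      with s show ?thesis
        unfolding abort_round_Suc by (simp add: lp_strategy_def)
    next
      case False
      have "strat_step T (Suc n) s (psum \<omega> n) (hint \<omega> (Suc n)) =
          map_pmf (\<lambda>x. (x, x)) (bernoulli_pmf ?q)"
        using False by (simp add: lp_strategy_def q_def state_at_def)
      with False s q show ?thesis
        unfolding abort_round_Suc by simp
    qed
  qed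
  also have "\<dots> = (\<Sum>i=1..n. q i \<omega> * survival i \<omega> * g True i) +
      survival (Suc n) \<omega> * (?q * g True (Suc n) + (1 - ?q) * g False (Suc (Suc n)))"
    using Suc.IH[of ?g] Suc.prems by simp
  also have "\<dots> = (\<Sum>i=1..Suc n. q i \<omega> * survival i \<omega> * g True i) +
      survival (Suc n + 1) \<omega> * g False (Suc n + 1)"
    by (simp add: survival_def algebra_simps atLeastLessThanSuc)
  finally show ?case .
qed

text \<open>Survival is 1 minus the chances of a first abort in each earlier round \<open>j\<close>.
  Splitting by the state \<open>u\<close> of that round, \<open>markov_states\<close> and the
  induction hypothesis give the abort probability at \<open>u\<close> times
  \<open>residual u\<close> times the probability of \<open>v\<close> given \<open>u\<close>, and
  the first two factors multiply to \<open>a u\<close>.\<close>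

lemma reach_prob:
  assumes "v \<in> layer i" "i \<in> {1..m}"
  shows "E (\<lambda>\<omega>. of_bool (\<omega> \<in> event m v) * survival i \<omega>) = residual v"
  using assms
proof (induction i arbitrary: v rule: less_induct)
  case (less i)
  let ?I = "\<lambda>v \<omega>. of_bool (\<omega> \<in> event m v) :: real"
  have i: "i = Suc (i - 1)" using less.prems by auto
  have abort: "E (\<lambda>\<omega>. ?I v \<omega> * (q j \<omega> * survival j \<omega>)) =
      (\<Sum>u\<in>layer j. a u * cprob_state m \<epsilon> f v u)" if j: "j \<in> {1..<i}" for j
  proof -
    have jm: "j \<in> {1..m}" and ij: "i \<in> {j<..m}" using j less.prems by auto
    have "E (\<lambda>\<omega>. ?I v \<omega> * (q j \<omega> * survival j \<omega>)) =
      E (\<lambda>\<omega>. \<Sum>u\<in>layer j. abort_prob m \<epsilon> f a u * (?I u \<omega> * ?I v \<omega> * survival j \<omega>))"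
    proof (rule expectation_cong)
      fix \<omega> assume "\<omega> \<in> set_pmf game"
      from sum_layer[OF this jm, of "abort_prob m \<epsilon> f a"]
      show "?I v \<omega> * (q j \<omega> * survival j \<omega>) =
        (\<Sum>u\<in>layer j. abort_prob m \<epsilon> f a u * (?I u \<omega> * ?I v \<omega> * survival j \<omega>))"
        unfolding q_def by (simp add: sum_distrib_left sum_distrib_right mult_ac)
    qed
    also have "\<dots> = (\<Sum>u\<in>layer j. abort_prob m \<epsilon> f a u *
        E (\<lambda>\<omega>. ?I u \<omega> * ?I v \<omega> * survival j \<omega>))"
      by (subst Bochner_Integration.integral_sum) auto
    also have "\<dots> = (\<Sum>u\<in>layer j. a u * cprob_state m \<epsilon> f v u)"
    proof (rule sum.cong)
      fix u assume u: "u \<in> layer j"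
      then have us: "u \<in> states m \<epsilon> f" by (simp add: layer_def)
      \<comment> \<open>Survival up to round \<open>j\<close> is independent of \<open>v\<close>
        given \<open>u\<close>, and its weight at \<open>u\<close> is known by the induction
        hypothesis.\<close>
      have "E (\<lambda>\<omega>. ?I u \<omega> * ?I v \<omega> * survival j \<omega>) = residual u * cprob_state m \<epsilon> f v u"
        using markov_states[OF u jm less.prems(1) ij survival_cong] less.IH[OF _ u jm] j by simp
      then show "abort_prob m \<epsilon> f a u * E (\<lambda>\<omega>. ?I u \<omega> * ?I v \<omega> * survival j \<omega>) =
          a u * cprob_state m \<epsilon> f v u"
        using abort_prob_times_residual[OF us] by (simp flip: mult.assoc)
    qed simp
    finally show ?thesis .
  qed
  have "E (\<lambda>\<omega>. ?I v \<omega> * survival i \<omega>) =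
      E (\<lambda>\<omega>. ?I v \<omega> - (\<Sum>j\<in>{1..<i}. ?I v \<omega> * (q j \<omega> * survival j \<omega>)))"
  proof (rule expectation_cong)
    fix \<omega>
    have "survival i \<omega> = 1 - (\<Sum>j\<in>{1..<i}. q j \<omega> * survival j \<omega>)"
      unfolding survival_def by (subst (1 2) i) (rule one_minus_prod)
    then show "?I v \<omega> * survival i \<omega> =
        ?I v \<omega> - (\<Sum>j\<in>{1..<i}. ?I v \<omega> * (q j \<omega> * survival j \<omega>))"
      by (simp add: right_diff_distrib sum_distrib_left)
  qed
  also have "\<dots> = prob_state m \<epsilon> f v - (\<Sum>j\<in>{1..<i}. E (\<lambda>\<omega>. ?I v \<omega> * (q j \<omega> * survival j \<omega>)))"
    unfolding prob_state_eq
    by (subst Bochner_Integration.integral_diff, simp, simp,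
        subst Bochner_Integration.integral_sum) simp_all
  also have "\<dots> = prob_state m \<epsilon> f v - (\<Sum>j\<in>{1..<i}. \<Sum>u\<in>layer j. a u * cprob_state m \<epsilon> f v u)"
    by (simp add: abort)
  also have "(\<Sum>j\<in>{1..<i}. \<Sum>u\<in>layer j. a u * cprob_state m \<epsilon> f v u) =
      (\<Sum>u\<in>{u \<in> states m \<epsilon> f. earlier u v}. a u * cprob_state m \<epsilon> f v u)"
    unfolding earlier_layers[OF less.prems] using less.prems layer_disjoint
    by (intro sum.UNION_disjoint[symmetric]) (auto simp: finite_layer)
  finally show ?case by (simp add: residual_def)
qed

section \<open>The bias\<close>

lemma val_state_at:
  assumes "i \<in> {1..m}"
  shows "val_nohint m \<epsilon> f \<omega> i = c_state m \<epsilon> f (state_at i \<omega>)"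
    and "val_hint m \<epsilon> f \<omega> i = v_state m \<epsilon> f (state_at i \<omega>)"
  \<comment> \<open>The level \<open>m - i + 1\<close> of round \<open>i\<close> gives back the
    index \<open>m - (m - i + 1) = i - 1\<close> of the partial sum.\<close>
  using assms by (simp_all add: val_nohint_def val_hint_def c_state_def v_state_def
      delta_def delta_hint_def state_at_def)

text \<open>The abort at a with-hint state \<open>v\<close> has probability
  \<open>abort_prob\<close> times \<open>residual\<close>, that is \<open>a v\<close>, and gains the
  difference of the values without and with the hint; linearity sums these gains.\<close>

lemma bias_lp_strategy: "bias m \<epsilon> f T = lp_objective m \<epsilon> f a"
proof -
  let ?gain = "\<lambda>v. c_state m \<epsilon> f v - v_state m \<epsilon> f v"
  have "bias m \<epsilon> f T = E (\<lambda>\<omega>. measure_pmf.expectation (strat_run T \<omega> m) (\<lambda>(s, out).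
      val_nohint m \<epsilon> f \<omega> (abort_round m out) - val_hint m \<epsilon> f \<omega> (abort_round m out)))"
    unfolding bias_def play_pmf_def
    by (simp add: expectation_bind_finite finite_game finite_run case_prod_unfold)
  also have "\<dots> = E (\<lambda>\<omega>. \<Sum>i=1..m. \<Sum>v\<in>layer i. abort_prob m \<epsilon> f a v * ?gain v *
      (of_bool (\<omega> \<in> event m v) * survival i \<omega>))"
  proof (rule expectation_cong)
    fix \<omega> assume \<omega>: "\<omega> \<in> set_pmf game"
    \<comment> \<open>The no-abort term at round \<open>m + 1\<close> drops out, since there both
      values are the indicator of a nonnegative final sum.\<close>
    have "measure_pmf.expectation (strat_run T \<omega> m) (\<lambda>(s, out).
        val_nohint m \<epsilon> f \<omega> (abort_round m out) - val_hint m \<epsilon> f \<omega> (abort_round m out)) =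
      (\<Sum>i=1..m. q i \<omega> * survival i \<omega> * (val_nohint m \<epsilon> f \<omega> i - val_hint m \<epsilon> f \<omega> i))"
      using run_expectation[of m \<omega> "\<lambda>_ i. val_nohint m \<epsilon> f \<omega> i - val_hint m \<epsilon> f \<omega> i"] q_bounds[OF \<omega>]
      by (simp add: val_nohint_def[of _ _ _ _ "Suc m"] val_hint_def[of _ _ _ _ "Suc m"])
    also have "\<dots> = (\<Sum>i=1..m. \<Sum>v\<in>layer i. abort_prob m \<epsilon> f a v * ?gain v *
      (of_bool (\<omega> \<in> event m v) * survival i \<omega>))"
    proof (rule sum.cong)
      fix i assume i: "i \<in> {1..m}"
      from sum_layer[OF \<omega> i, of "\<lambda>v. abort_prob m \<epsilon> f a v * ?gain v"]
      show "q i \<omega> * survival i \<omega> * (val_nohint m \<epsilon> f \<omega> i - val_hint m \<epsilon> f \<omega> i) =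
        (\<Sum>v\<in>layer i. abort_prob m \<epsilon> f a v * ?gain v * (of_bool (\<omega> \<in> event m v) * survival i \<omega>))"
        using i by (simp add: val_state_at q_def sum_distrib_left sum_distrib_right mult_ac)
    qed simp
    finally show "measure_pmf.expectation (strat_run T \<omega> m) (\<lambda>(s, out).
        val_nohint m \<epsilon> f \<omega> (abort_round m out) - val_hint m \<epsilon> f \<omega> (abort_round m out)) =
      (\<Sum>i=1..m. \<Sum>v\<in>layer i. abort_prob m \<epsilon> f a v * ?gain v *
        (of_bool (\<omega> \<in> event m v) * survival i \<omega>))" .
  qed
  also have "\<dots> = (\<Sum>i=1..m. \<Sum>v\<in>layer i. abort_prob m \<epsilon> f a v * ?gain v *
      E (\<lambda>\<omega>. of_bool (\<omega> \<in> event m v) * survival i \<omega>))"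
    by (simp add: Bochner_Integration.integral_sum)
  also have "\<dots> = (\<Sum>i=1..m. \<Sum>v\<in>layer i. a v * ?gain v)"
  proof (intro sum.cong refl)
    fix i v assume *: "i \<in> {1..m}" "v \<in> layer i"
    then have "abort_prob m \<epsilon> f a v * residual v = a v"
      by (intro abort_prob_times_residual) (simp add: layer_def)
    then show "abort_prob m \<epsilon> f a v * ?gain v *
        E (\<lambda>\<omega>. of_bool (\<omega> \<in> event m v) * survival i \<omega>) = a v * ?gain v"
      using reach_prob[OF *(2,1)] by (simp add: mult_ac)
  qed
  also have "\<dots> = (\<Sum>v\<in>(\<Union>i\<in>{1..m}. layer i). a v * ?gain v)"
    using layer_disjoint by (intro sum.UNION_disjoint[symmetric]) (auto simp: finite_layer)
  \<comment> \<open>Only final states lie outside the layers; for them \<open>event_minus\<close>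
    equals \<open>event\<close>, so the gain is 0.\<close>
  also have "\<dots> = (\<Sum>v\<in>states m \<epsilon> f. a v * ?gain v)"
  proof (rule sum.mono_neutral_left[OF finite_states])
    show "(\<Union>i\<in>{1..m}. layer i) \<subseteq> states m \<epsilon> f"
      by (auto simp: layer_def)
    show "\<forall>v\<in>states m \<epsilon> f - (\<Union>i\<in>{1..m}. layer i). a v * ?gain v = 0"
    proof
      fix v assume v: "v \<in> states m \<epsilon> f - (\<Union>i\<in>{1..m}. layer i)"
      show "a v * ?gain v = 0"
      proof (cases v)
        case (HintState l b h)
        then have "l \<in> {1..m}" using v by (simp add: states_def)
        then have "v \<in> layer (m - l + 1)" "m - l + 1 \<in> {1..m}"
          using v HintState by (auto simp: layer_def)
        then show ?thesis using v by blast
      qed (simp add: c_state_def v_state_def)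
    qed
  qed
  finally show ?thesis by (simp add: lp_objective_def)
qed

end

theorem lemma5p6:
  fixes m :: nat and \<epsilon> :: real and f :: "'h hint_fun" and a :: "'h state \<Rightarrow> real"
  assumes "\<epsilon> \<in> {-1..1}"
    and "hint_function m f"
    and "lp_feasible m \<epsilon> f a"
  shows "(\<forall>v\<in>states m \<epsilon> f. abort_prob m \<epsilon> f a v \<in> {0..1}) \<and>
         bias m \<epsilon> f (lp_strategy m \<epsilon> f a) = lp_objective m \<epsilon> f a"
proof -
  interpret lp_solution m \<epsilon> f a
    using assms by unfold_locales
  show ?thesis
    using abort_prob_bounds bias_lp_strategy by blast
qed

end
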